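(* Let $W$ and $V$ be $d$-dimensional worlds with barriers $B = (U_B, L_B)$ of $W$ and $C = (U_C, L_C)$ of $V$, and suppose there is an isomorphism of barriers between $(W,B)$ and $(V,C)$ with translation vector $t \in \mathbb{Z}^d$. Let $p \in L_B$ and let $q \in L_C$ be the position with $l_W(p) = l_V(q) + t$. Then $p$ is a $\mathcal{P}$-position if and only if $q$ is a $\mathcal{P}$-position.
   Context: Tree nim: a position is a finite tree, possibly empty, whose vertices carry positive integer sizes; a leaf is a vertex of degree at most $1$; a move chooses a leaf and decreases its size by a positive integer, deleting the vertex if its size becomes $0$; normal play. $p \rightarrow q$ means $q$ is reachable from $p$ in one move. A position is $\mathcal{P}$ iff no move leads to a $\mathcal{P}$-position. World: fix a finite tree $T$ with $d$ leaves ordered $l_1,\dots,l_d$, and fix positive sizes for its non-leaf vertices. Interior positions are the positions with underlying tree $T$, these non-leaf sizes and arbitrary positive leaf sizes; the world $W$ is the set of interior positions together with all positions seen by some interior position; positions of $W$ that are not interior are exterior (they arise by deleting one leaf of $T$). The lattice map $l_W$ sends a position of $W$ to the tuple of sizes of $l_1,\dots,l_d$, with $0$ for a deleted leaf; it is a bijection $W \to \{(n_1,\dots,n_d)\in\mathbb{N}_0^d : n_i = 0 \text{ for at most one } i\}$; $d$ is the dimension of $W$. A ray in $W$ is a family $R=(r_m)_{m\ge0}$ with $l_W(r_m) = (a_1,\dots,a_{k-1},m,a_{k+1},\dots,a_d)$ for some index $k$ (its variable coordinate) and positive integers $a_i$, $i\neq k$ (its fixed coordinates). Every such ray contains exactly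 one $\mathcal{P}$-position $r_m$; write $\mathcal{P}(R) = m$. Barrier: a partition $W = U_B \sqcup L_B$ such that $U_B$ contains all exterior positions, and whenever $p \in U_B$, $q \in W$ and $p \rightarrow q$, then $q \in U_B$. Shadow: a ray $R$ of $W$ meeting $L_B$ is shadowed if $\mathcal{P}(R) < n_0$, where $n_0$ is the least $m$ with $r_m \in L_B$; rays not meeting $L_B$ are not shadowed; $S(B)$ is the set of shadowed rays. Given $t\in\mathbb{Z}^d$, a ray $R$ of $W$ and a ray $R'$ of $V$ correspond if they have the same variable coordinate $k$ and their fixed coordinates satisfy $a_i = b_i + t_i$ for all $i\ne k$. An isomorphism of barriers between $(W,B)$ and $(V,C)$ with translation $t$ means: $l_W(L_B) = l_V(L_C) + t$, and for all corresponding rays $R$ of $W$ and $R'$ of $V$, $R \in S(B) \iff R' \in S(C)$. *)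

theory Defs
  imports "Jordan_Normal_Form.Matrix"
begin

section \<open>Finite trees\<close>

record 'a graph =
  verts :: "'a set"
  edges :: "'a set set"

definition simple_graph :: "('a, 'r) graph_scheme \<Rightarrow> bool" where
  "simple_graph G \<longleftrightarrow> finite (verts G) \<and> (\<forall>e\<in>edges G. e \<subseteq> verts G \<and> card e = 2)"

definition adjacency :: "('a, 'r) graph_scheme \<Rightarrow> ('a \<times> 'a) set" where
  "adjacency G = {(u, v). {u, v} \<in> edges G}"

definition connected_graph :: "('a, 'r) graph_scheme \<Rightarrow> bool" where
  "connected_graph G \<longleftrightarrow> (\<forall>u\<in>verts G. \<forall>v\<in>verts G. (u, v) \<in> (adjacency G)\<^sup>*)"

definition is_cycle :: "('a, 'r) graph_scheme \<Rightarrow> 'a list \<Rightarrow> bool" where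
  "is_cycle G c \<longleftrightarrow> length c \<ge> 3 \<and> distinct c \<and>
     (\<forall>i < length c. {c ! i, c ! (Suc i mod length c)} \<in> edges G)"

text \<open>The empty graph counts as a tree here.\<close>

definition is_tree :: "('a, 'r) graph_scheme \<Rightarrow> bool" where
  "is_tree G \<longleftrightarrow> simple_graph G \<and> connected_graph G \<and> (\<nexists>c. is_cycle G c)"

definition vdegree :: "('a, 'r) graph_scheme \<Rightarrow> 'a \<Rightarrow> nat" where
  "vdegree G v = card {e \<in> edges G. v \<in> e}"

definition leaves :: "('a, 'r) graph_scheme \<Rightarrow> 'a set" where
  "leaves G = {v \<in> verts G. vdegree G v \<le> 1}"


section \<open>Tree nim\<close>

record 'a position = "'a graph" +
  vsize :: "'a \<Rightarrow> nat"

text \<open>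
  Sizes are total functions; the value \<open>0\<close> is used exactly outside the vertex set, so that
  two positions are equal as soon as they have the same tree and the same vertex sizes.
\<close>

definition is_position :: "'a position \<Rightarrow> bool" where
  "is_position p \<longleftrightarrow> is_tree p \<and> (\<forall>v. 0 < vsize p v \<longleftrightarrow> v \<in> verts p)"

definition resize :: "'a position \<Rightarrow> 'a \<Rightarrow> nat \<Rightarrow> 'a position" where
  "resize p v n = p\<lparr>vsize := (vsize p)(v := n)\<rparr>"

definition delete_vertex :: "'a position \<Rightarrow> 'a \<Rightarrow> 'a position" where
  "delete_vertex p v =
     \<lparr>verts = verts p - {v}, edges = {e \<in> edges p. v \<notin> e}, vsize = (vsize p)(v := 0)\<rparr>"

definition move :: "'a position \<Rightarrow> 'a position \<Rightarrow> bool"  (infix \<open>\<leadsto>\<close> 50) where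
  "p \<leadsto> q \<longleftrightarrow> is_position p \<and>
     (\<exists>v\<in>leaves p. \<exists>n < vsize p v. q = (if n = 0 then delete_vertex p v else resize p v n))"

lemma delete_leaf_connected:
  assumes tree: "is_tree p" and v: "v \<in> leaves p"
  shows "connected_graph (delete_vertex p v)"
  unfolding connected_graph_def
proof (intro ballI)
  let ?q = "delete_vertex p v"
  fix x y
  assume "x \<in> verts ?q" and "y \<in> verts ?q"
  then have x: "x \<in> verts p" "x \<noteq> v" and y: "y \<in> verts p" "y \<noteq> v"
    by (auto simp: delete_vertex_def)
  have fin: "finite {e \<in> edges p. v \<in> e}"
  proof (rule finite_subset)
    show "{e \<in> edges p. v \<in> e} \<subseteq> Pow (verts p)" "finite (Pow (verts p))"
      using tree by (auto simp: is_tree_def simple_graph_def)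
  qed
  have unique: "e = e'" if "e \<in> edges p" "e' \<in> edges p" "v \<in> e" "v \<in> e'" for e e'
    using v fin that unfolding leaves_def vdegree_def One_nat_def by (simp add: card_le_Suc0_iff_eq)
  have no_loop: "{a, a} \<notin> edges p" for a
    using tree by (force simp: is_tree_def simple_graph_def)
  have "(x, y) \<in> (adjacency p)\<^sup>*"
    using tree x y by (simp add: is_tree_def connected_graph_def)
  then have "(y \<noteq> v \<longrightarrow> (x, y) \<in> (adjacency ?q)\<^sup>*) \<and>
    (y = v \<longrightarrow> (\<forall>w. {v, w} \<in> edges p \<longrightarrow> (x, w) \<in> (adjacency ?q)\<^sup>*))"
  proof (induction rule: rtrancl_induct)
    case base
    then show ?case using x by simp
  next
    case (step a b)
    have ab: "{a, b} \<in> edges p" using step by (simp add: adjacency_def)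
    show ?case
    proof (cases "b = v")
      case True
      then have av: "a \<noteq> v" using ab no_loop by auto
      have "w = a" if "{v, w} \<in> edges p" for w
        using unique[OF that ab] True av by (auto simp: doubleton_eq_iff)
      then show ?thesis using step True av by auto
    next
      case False
      show ?thesis
      proof (cases "a = v")
        case True
        then show ?thesis using step ab False by auto
      next
        case anv: False
        then have "(a, b) \<in> adjacency ?q"
          using ab False by (simp add: adjacency_def delete_vertex_def)
        then show ?thesis using step anv False by (meson rtrancl.rtrancl_into_rtrancl)
      qed
    qed
  qed
  then show "(x, y) \<in> (adjacency ?q)\<^sup>*" using y by simp
qed

lemma move_is_position:
  assumes "p \<leadsto> q"
  shows "is_position q"
proof -
  from assms obtain v n where p: "is_position p" and v: "v \<in> leaves p" and n: "n < vsize p v"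
    and q: "q = (if n = 0 then delete_vertex p v else resize p v n)"
    by (auto simp: move_def)
  show ?thesis
  proof (cases "n = 0")
    case True
    have "connected_graph q"
      using delete_leaf_connected[of p v] p v q True by (simp add: is_position_def)
    moreover have "simple_graph q"
      using p q True
      by (auto simp: is_position_def is_tree_def simple_graph_def delete_vertex_def)
    moreover have "\<not> is_cycle q c" for c
      using p q True
      by (auto simp: is_position_def is_tree_def is_cycle_def delete_vertex_def)
    ultimately show ?thesis
      using p q True by (simp add: is_position_def is_tree_def delete_vertex_def)
  next
    case False
    then show ?thesis using p q v
      by (auto simp: is_position_def is_tree_def simple_graph_def connected_graph_def
          adjacency_def is_cycle_def resize_def leaves_def)
  qed
qed

lemma move_decreases:
  assumes "p \<leadsto> q"
  shows "sum (vsize q) (verts q) < sum (vsize p) (verts p)"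
proof -
  from assms obtain v n where p: "is_position p" and v: "v \<in> leaves p" and n: "n < vsize p v"
    and q: "q = (if n = 0 then delete_vertex p v else resize p v n)"
    by (auto simp: move_def)
  have fin: "finite (verts p)" and vp: "v \<in> verts p"
    using p v by (auto simp: is_position_def is_tree_def simple_graph_def leaves_def)
  have "sum (vsize p) (verts p) = vsize p v + sum (vsize p) (verts p - {v})"
    using fin vp by (simp add: sum.remove)
  moreover have "sum (vsize q) (verts p - {v}) = sum (vsize p) (verts p - {v})"
    using q by (intro sum.cong) (auto simp: delete_vertex_def resize_def)
  moreover have "sum (vsize q) (verts q) = n + sum (vsize q) (verts p - {v})"
  proof (cases "n = 0")
    case True
    then show ?thesis using q by (simp add: delete_vertex_def)
  next
    case False
    then show ?thesis using q fin vp by (simp add: resize_def sum.remove)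
  qed
  ultimately show ?thesis using n by linarith
qed

function is_P :: "'a position \<Rightarrow> bool" where
  "is_P p \<longleftrightarrow> (\<forall>q. p \<leadsto> q \<longrightarrow> \<not> is_P q)"
  by pat_completeness auto
termination
  by (relation "measure (\<lambda>p. sum (vsize p) (verts p))") (auto simp: move_decreases)

declare is_P.simps [simp del]


section \<open>Worlds\<close>

record 'a world =
  wtree :: "'a graph"
  leaf_list :: "'a list"
  inner_size :: "'a \<Rightarrow> nat"

definition is_world :: "'a world \<Rightarrow> bool" where
  "is_world W \<longleftrightarrow> is_tree (wtree W) \<and>
     distinct (leaf_list W) \<and> set (leaf_list W) = leaves (wtree W) \<and>
     (\<forall>v \<in> verts (wtree W) - leaves (wtree W). 0 < inner_size W v)"

definition wdim :: "'a world \<Rightarrow> nat" where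
  "wdim W = length (leaf_list W)"

definition interior_positions :: "'a world \<Rightarrow> 'a position set" where
  "interior_positions W = {p. is_position p \<and> graph.truncate p = wtree W \<and>
     (\<forall>v \<in> verts (wtree W) - leaves (wtree W). vsize p v = inner_size W v)}"

definition world_positions :: "'a world \<Rightarrow> 'a position set" where
  "world_positions W = interior_positions W \<union> {q. \<exists>p \<in> interior_positions W. p \<leadsto> q}"

definition exterior_positions :: "'a world \<Rightarrow> 'a position set" where
  "exterior_positions W = world_positions W - interior_positions W"

text \<open>
  The values of the lattice map are taken in \<open>\<int>\<^sup>d\<close>, where they can be translated.
  A deleted leaf has size \<open>0\<close> by the convention in \<open>is_position\<close>.
  Coordinates are numbered from \<open>0\<close>.
\<close>

definition lattice_map :: "'a world \<Rightarrow> 'a position \<Rightarrow> int vec" where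
  "lattice_map W p = vec (wdim W) (\<lambda>i. int (vsize p (leaf_list W ! i)))"


section \<open>Rays, barriers and shadows\<close>

text \<open>
  Only the entries of \<open>a\<close> at indices different from \<open>k\<close> (the fixed coordinates) matter.
\<close>

definition ray_at :: "'a world \<Rightarrow> nat \<Rightarrow> int vec \<Rightarrow> (nat \<Rightarrow> 'a position) \<Rightarrow> bool" where
  "ray_at W k a R \<longleftrightarrow> k < wdim W \<and> a \<in> carrier_vec (wdim W) \<and>
     (\<forall>i < wdim W. i \<noteq> k \<longrightarrow> 0 < a $ i) \<and>
     (\<forall>m. R m \<in> world_positions W \<and>
          lattice_map W (R m) = vec (wdim W) (\<lambda>i. if i = k then int m else a $ i))"

definition is_ray :: "'a world \<Rightarrow> (nat \<Rightarrow> 'a position) \<Rightarrow> bool" where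
  "is_ray W R \<longleftrightarrow> (\<exists>k a. ray_at W k a R)"

text \<open>The description below is meaningful because each ray contains exactly one P-position.\<close>

definition ray_P :: "(nat \<Rightarrow> 'a position) \<Rightarrow> nat" where
  "ray_P R = (THE m. is_P (R m))"

definition barrier :: "'a world \<Rightarrow> 'a position set \<Rightarrow> 'a position set \<Rightarrow> bool" where
  "barrier W U L \<longleftrightarrow> U \<union> L = world_positions W \<and> U \<inter> L = {} \<and>
     exterior_positions W \<subseteq> U \<and>
     (\<forall>p \<in> U. \<forall>q \<in> world_positions W. p \<leadsto> q \<longrightarrow> q \<in> U)"

definition shadowed_rays :: "'a world \<Rightarrow> 'a position set \<Rightarrow> (nat \<Rightarrow> 'a position) set" where
  "shadowed_rays W L =
     {R. is_ray W R \<and> (\<exists>m. R m \<in> L) \<and> ray_P R < (LEAST m. R m \<in> L)}"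

definition corresponding_rays ::
  "'a world \<Rightarrow> 'b world \<Rightarrow> int vec \<Rightarrow> (nat \<Rightarrow> 'a position) \<Rightarrow> (nat \<Rightarrow> 'b position) \<Rightarrow> bool" where
  "corresponding_rays W V t R R' \<longleftrightarrow> (\<exists>k a b. ray_at W k a R \<and> ray_at V k b R' \<and>
     (\<forall>i < wdim W. i \<noteq> k \<longrightarrow> a $ i = b $ i + t $ i))"

text \<open>
  Shadows depend on a barrier only through its lower part, so only the sets \<open>L\<close> and \<open>L'\<close>
  of the two barriers enter.
\<close>

definition barrier_iso ::
  "'a world \<Rightarrow> 'a position set \<Rightarrow> 'b world \<Rightarrow> 'b position set \<Rightarrow> int vec \<Rightarrow> bool" where
  "barrier_iso W L V L' t \<longleftrightarrow>
     lattice_map W ` L = (\<lambda>x. x + t) ` (lattice_map V ` L') \<and>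
     (\<forall>R R'. corresponding_rays W V t R R' \<longrightarrow>
        (R \<in> shadowed_rays W L \<longleftrightarrow> R' \<in> shadowed_rays V L'))"

end

theory Submission
  imports Defs
begin

text \<open>
  By induction on the total size, it suffices to compare the options of \<open>p\<close> and \<open>q\<close> obtained by
  decreasing a single leaf \<open>l\<^sub>k\<close>. The options inside the lower parts of the barriers match up, and
  they are covered by the induction hypothesis. The ray through \<open>p\<close> in direction \<open>k\<close> meets the lower
  part in a final segment and has exactly one P-position, so some option outside the lower part
  is a P-position iff the ray is shadowed; by assumption this agrees for \<open>p\<close> and \<open>q\<close>.
\<close>

section \<open>The ray of a leaf\<close>

text \<open>Since \<open>n\<close> is unrestricted, the partial application
  \<open>leaf_option p v\<close> runs through the whole ray of \<open>v\<close> through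
  \<open>p\<close>, also above the current size; the moves at \<open>v\<close> are its values with
  \<open>n < vsize p v\<close>.\<close>

definition leaf_option :: "'a position \<Rightarrow> 'a \<Rightarrow> nat \<Rightarrow> 'a position" where
  "leaf_option p v n = (if n = 0 then delete_vertex p v else resize p v n)"

lemma move_iff_leaf_option:
  "p \<leadsto> q \<longleftrightarrow> is_position p \<and> (\<exists>v\<in>leaves p. \<exists>n < vsize p v. q = leaf_option p v n)"
  by (simp add: move_def leaf_option_def)

lemma not_is_P_iff:
  assumes "is_position p"
  shows "\<not> is_P p \<longleftrightarrow> (\<exists>v\<in>leaves p. \<exists>n < vsize p v. is_P (leaf_option p v n))"
  using assms by (subst is_P.simps) (auto simp: move_iff_leaf_option)

lemma vsize_leaf_option [simp]: "vsize (leaf_option p v n) = (vsize p)(v := n)"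
  by (simp add: leaf_option_def delete_vertex_def resize_def)

lemma leaf_option_vsize:
  assumes "0 < vsize p v"
  shows "leaf_option p v (vsize p v) = p"
  using assms by (simp add: leaf_option_def resize_def)

lemma leaves_resize [simp]: "leaves (resize p v n) = leaves p"
  by (simp add: leaves_def vdegree_def resize_def)

text \<open>A later size overwrites an earlier one, so every point with \<open>m > 0\<close>
  generates the same ray. After deletion, resizing would not restore the vertex.\<close>

lemma leaf_option_leaf_option:
  assumes "0 < m"
  shows "leaf_option (leaf_option p v m) v n = leaf_option p v n"
  using assms by (simp add: leaf_option_def resize_def delete_vertex_def)

lemma leaf_option_commute:
  assumes "v \<noteq> w" and "0 < m"
  shows "leaf_option (leaf_option p v m) w n = leaf_option (leaf_option p w n) v m"
  using assms by (simp add: leaf_option_def resize_def delete_vertex_def fun_upd_twist)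

lemma is_position_resize:
  assumes "is_position p" and "v \<in> verts p" and "0 < n"
  shows "is_position (resize p v n)"
  using assms
  by (auto simp: is_position_def is_tree_def simple_graph_def connected_graph_def
      adjacency_def is_cycle_def resize_def)

lemma vsize_leaf_pos:
  assumes "is_position p" and "v \<in> leaves p"
  shows "0 < vsize p v"
  using assms by (simp add: is_position_def leaves_def)

lemma is_position_leaf_option:
  assumes "is_position p" and "v \<in> leaves p"
  shows "is_position (leaf_option p v n)"
proof (cases "n = 0")
  case True
  then have "p \<leadsto> leaf_option p v n"
    using assms vsize_leaf_pos[OF assms] unfolding move_iff_leaf_option by blast
  then show ?thesis by (rule move_is_position)
next
  case False
  then show ?thesis
    using is_position_resize[of p v n] assms by (simp add: leaf_option_def leaves_def)
qed

lemma finite_edges: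
  assumes "simple_graph G"
  shows "finite (edges G)"
  by (rule finite_subset[of _ "Pow (verts G)"]) (use assms in \<open>auto simp: simple_graph_def\<close>)

text \<open>Deleting \<open>w\<close> can only remove edges, so the degree of \<open>v\<close> does
  not grow.\<close>

lemma leaf_of_leaf_option:
  assumes p: "is_position p" and v: "v \<in> leaves p" and "v \<noteq> w"
  shows "v \<in> leaves (leaf_option p w n)"
proof (cases "n = 0")
  case True
  have "finite (edges p)"
    using p by (simp add: is_position_def is_tree_def finite_edges)
  then have "vdegree (delete_vertex p w) v \<le> vdegree p v"
    unfolding vdegree_def by (intro card_mono) (auto simp: delete_vertex_def)
  then show ?thesis
    using True v \<open>v \<noteq> w\<close> by (auto simp: leaf_option_def leaves_def delete_vertex_def)
next
  case False
  then show ?thesis using v by (simp add: leaf_option_def)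
qed

lemma move_along_leaf:
  assumes "is_position p" and "v \<in> leaves p" and "n < m"
  shows "leaf_option p v m \<leadsto> leaf_option p v n"
proof -
  have "v \<in> leaves (leaf_option p v m)"
    using assms by (simp add: leaf_option_def)
  moreover have "leaf_option (leaf_option p v m) v n = leaf_option p v n"
    using assms by (intro leaf_option_leaf_option) simp
  ultimately show ?thesis
    using assms is_position_leaf_option[of p v m] unfolding move_iff_leaf_option
    by (metis fun_upd_same vsize_leaf_option)
qed

section \<open>Existence and uniqueness of the P-position on a ray\<close>

text \<open>The larger of two points of a ray has a move to the smaller one, so they cannot both be
  P-positions.\<close>

lemma P_option_unique:
  assumes "is_position p" and "v \<in> leaves p"
    and "is_P (leaf_option p v m)" and "is_P (leaf_option p v n)"
  shows "m = n"
proof -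
  have "\<not> i < j" if "is_P (leaf_option p v i)" "is_P (leaf_option p v j)" for i j
    using that move_along_leaf[OF assms(1,2), of i j] is_P.simps[of "leaf_option p v j"] by blast
  then show ?thesis using assms(3,4) by (meson linorder_neqE_nat)
qed

text \<open>On a ray without P-positions every point would have a winning reply at another leaf.
  Only finitely many replies are available, so one serves infinitely many \<open>m\<close>, which
  contradicts uniqueness on the ray reached by that reply.\<close>

lemma P_option_exists:
  assumes p: "is_position p" and v: "v \<in> leaves p"
  shows "\<exists>m. is_P (leaf_option p v m)"
proof (rule ccontr)
  assume none: "\<nexists>m. is_P (leaf_option p v m)"
  \<comment> \<open>Sizes of leaves other than \<open>v\<close> do not depend on \<open>m\<close>,
    so this finite set contains every reply away from \<open>v\<close>.\<close>
  define A where "A = (SIGMA w : leaves p. {..<vsize p w})"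
  have "finite (leaves p)"
    using p by (simp add: is_position_def is_tree_def simple_graph_def leaves_def)
  then have "finite A" by (simp add: A_def)
  have "\<exists>x\<in>A. fst x \<noteq> v \<and> is_P (leaf_option (leaf_option p v m) (fst x) (snd x))"
    if "m \<in> {0<..}" for m
  proof -
    have "leaves (leaf_option p v m) = leaves p"
      using that by (simp add: leaf_option_def)
    then obtain w n where w: "w \<in> leaves p" and n: "n < vsize (leaf_option p v m) w"
      and P: "is_P (leaf_option (leaf_option p v m) w n)"
      using none not_is_P_iff[OF is_position_leaf_option[OF p v, of m]] by auto
    \<comment> \<open>A reply at \<open>v\<close> would end on the same ray, which is assumed to
      contain no P-position.\<close>
    moreover have "w \<noteq> v"
      using P none leaf_option_leaf_option[of m p v n] that by auto
    ultimately show ?thesis by (intro bexI[of _ "(w, n)"]) (auto simp: A_def)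
  qed
  then have "\<forall>m\<in>{0<..}. \<exists>x\<in>A. fst x \<noteq> v \<and>
      is_P (leaf_option (leaf_option p v m) (fst x) (snd x))" ..
  \<comment> \<open>Infinitely many \<open>m\<close> share the same winning reply \<open>x\<close> away from the leaf \<open>v\<close>.\<close>
  from pigeonhole_infinite_rel[OF infinite_Ioi \<open>finite A\<close> this]
  obtain x where x: "x \<in> A"
    and inf': "infinite {m \<in> {0<..}. fst x \<noteq> v \<and>
      is_P (leaf_option (leaf_option p v m) (fst x) (snd x))}"
    by blast
  obtain w n where wn: "x = (w, n)" by fastforce
  define M where "M = {m \<in> {0<..}. w \<noteq> v \<and> is_P (leaf_option (leaf_option p v m) w n)}"
  have inf: "infinite M" using inf' by (simp add: M_def wn)
  \<comment> \<open>The reply commutes with setting the size of \<open>v\<close>, so each element of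
    \<open>M\<close> marks a P-position on the ray of \<open>v\<close> through
    \<open>leaf_option p w n\<close>.\<close>
  have "m = m'" if "m \<in> M" "m' \<in> M" for m m'
  proof (rule P_option_unique)
    show "is_position (leaf_option p w n)"
      using p x wn by (auto simp: A_def is_position_leaf_option)
    show "v \<in> leaves (leaf_option p w n)"
      using leaf_of_leaf_option[OF p v] that by (auto simp: M_def)
    show "is_P (leaf_option (leaf_option p w n) v m)" "is_P (leaf_option (leaf_option p w n) v m')"
      using that by (auto simp: M_def leaf_option_commute[of v w])
  qed
  moreover have "M \<noteq> {}" using inf by auto
  ultimately obtain m where "M \<subseteq> {m}" by blast
  then show False using inf finite_subset by blast
qed

text \<open>Existence and uniqueness justify the definite description in
  \<open>ray_P\<close>.\<close>

lemma ray_P_leaf_option: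
  assumes "is_position p" and "v \<in> leaves p"
  shows "is_P (leaf_option p v m) \<longleftrightarrow> ray_P (leaf_option p v) = m"
proof -
  obtain n where n: "is_P (leaf_option p v n)" using P_option_exists[OF assms] by blast
  then have "ray_P (leaf_option p v) = n"
    unfolding ray_P_def using P_option_unique[OF assms] by blast
  then show ?thesis using n P_option_unique[OF assms] by blast
qed


section \<open>Rays and barriers of a world\<close>

lemma interior_is_position: "p \<in> interior_positions W \<Longrightarrow> is_position p"
  by (simp add: interior_positions_def)

lemma interior_verts_edges:
  assumes "p \<in> interior_positions W"
  shows "verts p = verts (wtree W)" and "edges p = edges (wtree W)"
proof -
  have "wtree W = graph.truncate p" using assms by (simp add: interior_positions_def)
  then show "verts p = verts (wtree W)" and "edges p = edges (wtree W)"
    by (simp_all add: graph.truncate_def)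
qed

lemma leaves_interior:
  assumes "is_world W" and "p \<in> interior_positions W"
  shows "leaves p = set (leaf_list W)"
  using assms interior_verts_edges[OF assms(2)]
  by (simp add: is_world_def leaves_def vdegree_def)

lemma leaf_list_nth_in_leaves:
  assumes "is_world W" and "p \<in> interior_positions W" and "k < wdim W"
  shows "leaf_list W ! k \<in> leaves p"
  using assms by (simp add: leaves_interior wdim_def)

lemma leaf_list_nth_eq_iff:
  assumes "is_world W" and "i < wdim W" and "k < wdim W"
  shows "leaf_list W ! i = leaf_list W ! k \<longleftrightarrow> i = k"
  using assms by (simp add: is_world_def wdim_def nth_eq_iff_index_eq)

lemma lattice_map_nth [simp]:
  "i < wdim W \<Longrightarrow> lattice_map W p $ i = int (vsize p (leaf_list W ! i))"
  by (simp add: lattice_map_def)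

lemma lattice_map_carrier [simp]: "lattice_map W p \<in> carrier_vec (wdim W)"
  by (simp add: lattice_map_def)

lemma dim_lattice_map [simp]: "dim_vec (lattice_map W p) = wdim W"
  by (simp add: lattice_map_def)

text \<open>The coordinates determine the leaf sizes, \<open>W\<close> fixes the tree and the inner
  sizes, and all sizes outside the tree are \<open>0\<close>.\<close>

lemma lattice_map_inj_on_interior:
  assumes W: "is_world W"
  shows "inj_on (lattice_map W) (interior_positions W)"
proof (rule inj_onI)
  fix p q
  assume p: "p \<in> interior_positions W" and q: "q \<in> interior_positions W"
    and eq: "lattice_map W p = lattice_map W q"
  have "vsize p v = vsize q v" for v
  proof -
    consider (leaf) "v \<in> leaves (wtree W)" | (inner) "v \<in> verts (wtree W) - leaves (wtree W)"
      | (out) "v \<notin> verts (wtree W)"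
      by blast
    then show ?thesis
    proof cases
      case leaf
      then obtain i where "i < wdim W" "v = leaf_list W ! i"
        using W by (metis is_world_def wdim_def in_set_conv_nth)
      then show ?thesis using arg_cong[OF eq, of "\<lambda>x. x $ i"] by simp
    next
      case inner
      then show ?thesis using p q by (simp add: interior_positions_def)
    next
      case out
      then have "v \<notin> verts p" "v \<notin> verts q"
        using interior_verts_edges p q by blast+
      then show ?thesis using p q by (simp add: interior_positions_def is_position_def) (metis neq0_conv)
    qed
  qed
  then show "p = q" using interior_verts_edges[OF p] interior_verts_edges[OF q]
    by (intro position.equality) auto
qed

lemma leaf_option_interior:
  assumes W: "is_world W" and p: "p \<in> interior_positions W" and v: "v \<in> leaves p" and "0 < n"
  shows "leaf_option p v n \<in> interior_positions W"
proof -
  have "is_position (leaf_option p v n)"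
    using p v by (simp add: is_position_leaf_option interior_is_position)
  moreover have "v \<in> leaves (wtree W)"
    using W leaves_interior[OF W p] v by (simp add: is_world_def)
  ultimately show ?thesis
    using p \<open>0 < n\<close>
    by (auto simp: interior_positions_def leaf_option_def resize_def graph.truncate_def)
qed

lemma leaf_option_world:
  assumes "is_world W" and "p \<in> interior_positions W" and "v \<in> leaves p"
  shows "leaf_option p v n \<in> world_positions W"
proof (cases "n = 0")
  case True
  then have "p \<leadsto> leaf_option p v n"
    using assms(3) interior_is_position[OF assms(2)] vsize_leaf_pos[of p v]
    unfolding move_iff_leaf_option by blast
  then show ?thesis using assms by (auto simp: world_positions_def)
next
  case False
  then show ?thesis using leaf_option_interior assms by (auto simp: world_positions_def)
qed

lemma lattice_map_leaf_option:
  assumes "is_world W" and "k < wdim W"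
  shows "lattice_map W (leaf_option p (leaf_list W ! k) n) =
    vec (wdim W) (\<lambda>i. if i = k then int n else lattice_map W p $ i)"
  using assms by (auto intro!: eq_vecI simp: leaf_list_nth_eq_iff)

lemma ray_at_leaf_option:
  assumes W: "is_world W" and p: "p \<in> interior_positions W" and k: "k < wdim W"
  shows "ray_at W k (lattice_map W p) (leaf_option p (leaf_list W ! k))"
proof -
  have "0 < vsize p (leaf_list W ! i)" if "i < wdim W" for i
    using vsize_leaf_pos interior_is_position[OF p] leaf_list_nth_in_leaves[OF W p that] .
  then show ?thesis
    unfolding ray_at_def
    using k lattice_map_leaf_option[OF W k]
      leaf_option_world[OF W p leaf_list_nth_in_leaves[OF W p k]]
    by auto
qed

section \<open>Barriers and shadows along a ray\<close>

lemma barrier_lower_interior: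
  assumes "barrier W U L"
  shows "L \<subseteq> interior_positions W"
  using assms by (auto simp: barrier_def exterior_positions_def)

text \<open>Reduces shadows to options of \<open>p\<close>: as \<open>p\<close> itself lies in
  \<open>L\<close>, all points of the ray before its first point in \<open>L\<close> are reachable
  from \<open>p\<close> in one move.\<close>

lemma shadowed_rays_iff:
  assumes W: "is_world W" and B: "barrier W U L" and p: "p \<in> L" and k: "k < wdim W"
  defines "v \<equiv> leaf_list W ! k"
  shows "leaf_option p v \<in> shadowed_rays W L \<longleftrightarrow>
    (\<exists>n < vsize p v. is_P (leaf_option p v n) \<and> leaf_option p v n \<notin> L)"
proof -
  have int: "p \<in> interior_positions W" using B p barrier_lower_interior by blast
  have pos: "is_position p" using int by (rule interior_is_position)
  have v: "v \<in> leaves p" unfolding v_def using W int k by (rule leaf_list_nth_in_leaves)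
  have pL: "leaf_option p v (vsize p v) \<in> L"
    using p leaf_option_vsize[OF vsize_leaf_pos[OF pos v]] by simp
  have ray: "is_ray W (leaf_option p v)"
    unfolding is_ray_def v_def using ray_at_leaf_option[OF W int k] by blast
  \<comment> \<open>Otherwise a move would lead from \<open>U\<close> at \<open>m\<close> down to
    \<open>L\<close> at \<open>n\<close>, although \<open>U\<close> is closed under moves.\<close>
  have mono: "leaf_option p v m \<in> L" if "leaf_option p v n \<in> L" "n < m" for m n
  proof (rule ccontr)
    assume "leaf_option p v m \<notin> L"
    then have "leaf_option p v m \<in> U"
      using B leaf_option_world[OF W int v] by (auto simp: barrier_def)
    then have "leaf_option p v n \<in> U"
      using B leaf_option_world[OF W int v] move_along_leaf[OF pos v \<open>n < m\<close>]
      by (auto simp: barrier_def)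
    then show False using that B by (auto simp: barrier_def)
  qed
  define n\<^sub>0 where "n\<^sub>0 = (LEAST m. leaf_option p v m \<in> L)"
  have n0: "leaf_option p v n\<^sub>0 \<in> L" unfolding n\<^sub>0_def using pL by (rule LeastI)
  have less_n0: "m < n\<^sub>0 \<longleftrightarrow> leaf_option p v m \<notin> L" for m
    using n0 mono not_less_Least[of m "\<lambda>m. leaf_option p v m \<in> L"]
    unfolding n\<^sub>0_def[symmetric] by (metis linorder_neqE_nat)
  have n0_le: "n\<^sub>0 \<le> vsize p v" unfolding n\<^sub>0_def using pL by (rule Least_le)
  have "leaf_option p v \<in> shadowed_rays W L \<longleftrightarrow> ray_P (leaf_option p v) < n\<^sub>0"
    using ray pL by (auto simp: shadowed_rays_def n\<^sub>0_def)
  also have "\<dots> \<longleftrightarrow> (\<exists>n < n\<^sub>0. is_P (leaf_option p v n))"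
    by (auto simp: ray_P_leaf_option[OF pos v])
  also have "\<dots> \<longleftrightarrow> (\<exists>n < vsize p v. is_P (leaf_option p v n) \<and> leaf_option p v n \<notin> L)"
    using less_n0 n0_le by (metis order_less_le_trans)
  finally show ?thesis .
qed


section \<open>Isomorphic barriers\<close>

lemma lattice_map_translate_sym:
  assumes "t \<in> carrier_vec (wdim W)" and "wdim V = wdim W"
    and "lattice_map W p = lattice_map V q + t"
  shows "lattice_map V q = lattice_map W p + - t"
  using assms by (auto intro!: eq_vecI)

lemma corresponding_rays_sym:
  assumes "t \<in> carrier_vec (wdim W)" and "wdim V = wdim W"
    and "corresponding_rays V W (- t) R' R"
  shows "corresponding_rays W V t R R'"
proof -
  from assms obtain k a b where "ray_at V k a R'" "ray_at W k b R"
    and "\<And>i. i < wdim W \<Longrightarrow> i \<noteq> k \<Longrightarrow> a $ i = b $ i + (- t) $ i"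
    unfolding corresponding_rays_def by auto
  moreover from this have "b $ i = a $ i + t $ i" if "i < wdim W" "i \<noteq> k" for i
    using that assms(1) by simp
  ultimately show ?thesis unfolding corresponding_rays_def by blast
qed

text \<open>With this symmetry, one implication between \<open>p\<close> and \<open>q\<close>,
  proved for arbitrary isomorphic barriers, yields the equivalence.\<close>

lemma barrier_iso_sym:
  assumes t: "t \<in> carrier_vec (wdim W)" and d: "wdim V = wdim W" and iso: "barrier_iso W L V L' t"
  shows "barrier_iso V L' W L (- t)"
proof -
  have "(\<lambda>x. x + - t) ` lattice_map W ` L = (\<lambda>x. x + t + - t) ` lattice_map V ` L'"
    using iso by (simp add: barrier_iso_def image_image)
  also have "\<dots> = lattice_map V ` L'"
  proof -
    have "x + t + - t = x" if "x \<in> lattice_map V ` L'" for x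
      using that t d by (auto intro!: eq_vecI)
    then show ?thesis by simp
  qed
  finally have "lattice_map V ` L' = (\<lambda>x. x + - t) ` lattice_map W ` L" ..
  moreover have "R' \<in> shadowed_rays V L' \<longleftrightarrow> R \<in> shadowed_rays W L"
    if "corresponding_rays V W (- t) R' R" for R R'
    using iso corresponding_rays_sym[OF t d that] by (simp add: barrier_iso_def)
  ultimately show ?thesis unfolding barrier_iso_def by simp
qed

section \<open>Transfer of winning moves across an isomorphism\<close>

text \<open>A winning move of \<open>p\<close> at the leaf with index \<open>k\<close> yields one of
  \<open>q\<close> at the leaf with the same index: by the induction hypothesis if it stays in
  \<open>L\<close>, by the shadow of the ray if it leaves \<open>L\<close>. In \<open>IH\<close>
  both positions are options, so that it remains usable when the two worlds are exchanged.\<close>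

lemma not_is_P_transfer:
  assumes W: "is_world W" and V: "is_world V" and d: "wdim V = wdim W"
    and B: "barrier W U L" and C: "barrier V U' L'"
    and t: "t \<in> carrier_vec (wdim W)" and iso: "barrier_iso W L V L' t"
    and p: "p \<in> L" and q: "q \<in> L'" and pq: "lattice_map W p = lattice_map V q + t"
    and IH: "\<And>p' q'. p \<leadsto> p' \<Longrightarrow> q \<leadsto> q' \<Longrightarrow> p' \<in> L \<Longrightarrow> q' \<in> L' \<Longrightarrow>
      lattice_map W p' = lattice_map V q' + t \<Longrightarrow> is_P p' \<longleftrightarrow> is_P q'"
    and N: "\<not> is_P p"
  shows "\<not> is_P q"
proof -
  have p_int: "p \<in> interior_positions W" using B p barrier_lower_interior by blast
  have q_int: "q \<in> interior_positions V" using C q barrier_lower_interior by blast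
  have pos: "is_position p" "is_position q"
    using p_int q_int by (auto simp: interior_is_position)
  have coord: "int (vsize p (leaf_list W ! i)) = int (vsize q (leaf_list V ! i)) + t $ i"
    if "i < wdim W" for i
    using arg_cong[OF pq, of "\<lambda>x. x $ i"] that d t by simp
  obtain v n where v: "v \<in> leaves p" and n: "n < vsize p v" and P: "is_P (leaf_option p v n)"
    using N not_is_P_iff[OF pos(1)] by blast
  obtain k where k: "k < wdim W" and vk: "v = leaf_list W ! k"
    using v leaves_interior[OF W p_int] by (metis wdim_def in_set_conv_nth)
  define w where "w = leaf_list V ! k"
  have w: "w \<in> leaves q"
    unfolding w_def using leaf_list_nth_in_leaves[OF V q_int] k d by simp
  have "\<exists>m < vsize q w. is_P (leaf_option q w m)"
  proof (cases "leaf_option p v n \<in> L")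
    case True
    then obtain q' where q': "q' \<in> L'"
      and eq: "lattice_map W (leaf_option p v n) = lattice_map V q' + t"
      using iso unfolding barrier_iso_def by blast
    have coord': "(if i = k then int n else int (vsize p (leaf_list W ! i))) =
        int (vsize q' (leaf_list V ! i)) + t $ i" if "i < wdim W" for i
      using arg_cong[OF eq, of "\<lambda>x. x $ i"] that d t k
      by (auto simp: vk leaf_list_nth_eq_iff[OF W] split: if_splits)
    have q'_int: "q' \<in> interior_positions V" using C q' barrier_lower_interior by blast
    \<comment> \<open>Here \<open>m\<close> is \<open>n\<close> minus the entry of \<open>t\<close>
      at \<open>k\<close>. It is positive because \<open>q'\<close> is interior, and below
      \<open>vsize q w\<close> because \<open>p\<close> and \<open>q\<close> differ by the same
      shift.\<close>
    define m where "m = vsize q' w"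
    have "0 < m"
      unfolding m_def w_def
      using vsize_leaf_pos[OF interior_is_position[OF q'_int] leaf_list_nth_in_leaves[OF V q'_int]] k d
      by simp
    have "m < vsize q w"
      using coord[OF k] coord'[OF k] n by (simp add: m_def w_def vk)
    \<comment> \<open>The isomorphism gives \<open>q'\<close> only as some position of
      \<open>L'\<close>; comparing coordinates identifies it with an option of
      \<open>q\<close>.\<close>
    have "lattice_map V (leaf_option q w m) = lattice_map V q'"
    proof (rule eq_vecI)
      fix i assume "i < dim_vec (lattice_map V q')"
      then have i: "i < wdim W" using d by simp
      then show "lattice_map V (leaf_option q w m) $ i = lattice_map V q' $ i"
        using coord[OF i] coord'[OF i] k d
        by (auto simp: w_def m_def leaf_list_nth_eq_iff[OF V])
    qed simp
    then have q'_eq: "leaf_option q w m = q'"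
      using inj_onD[OF lattice_map_inj_on_interior[OF V]] q'_int
        leaf_option_interior[OF V q_int w \<open>0 < m\<close>] by blast
    have "p \<leadsto> leaf_option p v n" "q \<leadsto> q'"
      using pos v w n \<open>m < vsize q w\<close> q'_eq by (auto simp: move_iff_leaf_option)
    then have "is_P q'" using IH True q' eq P by blast
    then show ?thesis using \<open>m < vsize q w\<close> q'_eq by blast
  next
    \<comment> \<open>The P-option lies before the ray enters \<open>L\<close>, so the ray is
      shadowed. The corresponding ray through \<open>q\<close> is then shadowed too, which provides
      a P-option of \<open>q\<close> outside \<open>L'\<close>.\<close>
    case False
    then have "leaf_option p v \<in> shadowed_rays W L"
      using shadowed_rays_iff[OF W B p k] P n vk by blast
    moreover have "corresponding_rays W V t (leaf_option p v) (leaf_option q w)"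
      unfolding corresponding_rays_def
    proof (intro exI conjI allI impI)
      show "ray_at W k (lattice_map W p) (leaf_option p v)"
        unfolding vk by (rule ray_at_leaf_option[OF W p_int k])
      show "ray_at V k (lattice_map V q) (leaf_option q w)"
        unfolding w_def using ray_at_leaf_option[OF V q_int] k d by simp
      show "lattice_map W p $ i = lattice_map V q $ i + t $ i" if "i < wdim W" for i
        using coord that d by simp
    qed
    ultimately have "leaf_option q w \<in> shadowed_rays V L'"
      using iso by (simp add: barrier_iso_def)
    then show ?thesis
      using shadowed_rays_iff[OF V C q, of k] k d by (auto simp: w_def)
  qed
  then show ?thesis using not_is_P_iff[OF pos(2)] w by blast
qed

theorem mainTheorem5:
  fixes W :: "'a world" and V :: "'b world" and d :: nat
    and U\<^sub>B L\<^sub>B :: "'a position set" and U\<^sub>C L\<^sub>C :: "'b position set"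
    and t :: "int vec" and p :: "'a position" and q :: "'b position"
  assumes "is_world W" and "wdim W = d"
    and "is_world V" and "wdim V = d"
    and "barrier W U\<^sub>B L\<^sub>B" and "barrier V U\<^sub>C L\<^sub>C"
    and "t \<in> carrier_vec d" and "barrier_iso W L\<^sub>B V L\<^sub>C t"
    and "p \<in> L\<^sub>B" and "q \<in> L\<^sub>C" and "lattice_map W p = lattice_map V q + t"
  shows "is_P p \<longleftrightarrow> is_P q"
  using assms(9-11)
\<comment> \<open>The total size of \<open>p\<close> alone is the measure: in every pair of options
  compared, the first is an option of \<open>p\<close>.\<close>
proof (induction p arbitrary: q rule: measure_induct_rule[of "\<lambda>p. sum (vsize p) (verts p)"])
  case (less p)
  have VW: "wdim V = wdim W" and WV: "wdim W = wdim V" and tW: "t \<in> carrier_vec (wdim W)"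
    and tV: "- t \<in> carrier_vec (wdim V)"
    using assms by simp_all
  have IH: "is_P p' \<longleftrightarrow> is_P q'" if "p \<leadsto> p'" "p' \<in> L\<^sub>B" "q' \<in> L\<^sub>C"
    "lattice_map W p' = lattice_map V q' + t" for p' q'
    using less.IH move_decreases that by blast
  have "\<not> is_P p \<Longrightarrow> \<not> is_P q"
    by (rule not_is_P_transfer[OF assms(1,3) VW assms(5,6) tW assms(8) less.prems])
      (use IH in blast)+
  \<comment> \<open>The two worlds change roles and \<open>t\<close> becomes \<open>- t\<close>; the
    induction hypothesis still applies because \<open>p'\<close> is smaller than
    \<open>p\<close>.\<close>
  moreover have "\<not> is_P q \<Longrightarrow> \<not> is_P p"
  proof (rule not_is_P_transfer[OF assms(3,1) WV assms(6,5) tV])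
    show "barrier_iso V L\<^sub>C W L\<^sub>B (- t)" using barrier_iso_sym[OF tW VW assms(8)] .
    show "lattice_map V q = lattice_map W p + - t"
      using lattice_map_translate_sym[OF tW VW less.prems(3)] .
    fix q' p'
    assume "p \<leadsto> p'" "p' \<in> L\<^sub>B" "q' \<in> L\<^sub>C" and "lattice_map V q' = lattice_map W p' + - t"
    then show "is_P q' \<longleftrightarrow> is_P p'"
      using lattice_map_translate_sym[OF tV WV] IH by fastforce
  qed (use less.prems in blast)+
  ultimately show ?case by blast
qed

end
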